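(* Let $\mu_1,\dots,\mu_n$ be in $]0,1[$ with $\mu_i\neq\frac12$. Then it holds for $t\geqslant0$ that $$\rho_{n,\star}^{\mathrm{exp}}(t)\leqslant\exp\left(\frac{nt^2/2}{\frac1n\sum_{i=1}^n\log\left(\frac{\mu_i}{1-\mu_i}\right)}\right).$$ In addition, $\rho_{n,\star}^{\mathrm{exp}}(t)\leqslant\rho_n^{\mathrm{Hoeffding}}$.
   Context: For means $\mu_1,\dots,\mu_n$ of independent random variables taking their values in $[0,1]$, $\bar\mu_n=\frac1n\sum_{i=1}^n\mu_i$ and $t\geqslant0$, let $$\rho_{n,\star}^{\mathrm{exp}}(t)=\inf_{\lambda\in\mathbb{R}}\ e^{-n\lambda(\bar\mu_n+t)}\prod_{i=1}^n\big(1+\mu_i(e^\lambda-1)\big).$$ The Hoeffding bound for variables in $[0,1]$ is $\rho_n^{\mathrm{Hoeffding}}=\exp(-2nt^2)$.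
   Formalization: The displayed first bound is false (e.g. n=1, μ_1=0.49, t=0.01), and its denominator can vanish; what is proved has each summand log(μ_i/(1-μ_i)) replaced by (1/2-μ_i)/log(μ_i/(1-μ_i)). The Hoeffding comparison is unchanged. *)

theory Defs
  imports "HOL-Analysis.Analysis"
begin

definition mean_bar :: "nat \<Rightarrow> (nat \<Rightarrow> real) \<Rightarrow> real" where
  "mean_bar n \<mu> = (1 / real n) * (\<Sum>i=1..n. \<mu> i)"

(* For \<mu> i in [0,1] the objective is nonnegative, so the infimum over the reals is a genuine one. *)
definition rho_exp_star :: "nat \<Rightarrow> (nat \<Rightarrow> real) \<Rightarrow> real \<Rightarrow> real" where
  "rho_exp_star n \<mu> t =
     (INF l::real. exp (- real n * l * (mean_bar n \<mu> + t)) *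
        (\<Prod>i=1..n. 1 + \<mu> i * (exp l - 1)))"

definition rho_Hoeffding :: "nat \<Rightarrow> real \<Rightarrow> real" where
  "rho_Hoeffding n t = exp (- 2 * real n * t\<^sup>2)"

end

theory Submission
  imports Defs
begin

text \<open>
  Each factor of the objective is dominated by a Gaussian moment generating function (the
  Kearns--Saul inequality), after which the choice \<open>l = t / K\<close>, with \<open>K\<close> minus the mean of
  \<open>(1/2 - \<mu> i) / ln (\<mu> i / (1 - \<mu> i))\<close>, minimises the quadratic exponent. With
  \<open>w = ln (\<mu> / (1 - \<mu>)) / 2\<close> and \<open>v = l / 2 + w\<close> the moment generating function
  is \<open>1 + \<mu> (exp l - 1) = exp (l / 2) * cosh v / cosh w\<close>, so the Kearns--Saul inequality says that
  the function \<open>ln (cosh (sqrt x))\<close> lies below its tangent at \<open>x = w\<^sup>2\<close>; it is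
  concave because \<open>tanh v / v\<close> decreases on the positive reals. The Hoeffding bound follows
  from \<open>tanh w \<le> w\<close>, which gives \<open>K \<le> 1/4\<close>.
\<close>

lemma sinh_ge_self:
  fixes x :: real
  assumes "0 \<le> x"
  shows "x \<le> sinh x"
proof -
  have "(\<lambda>y. sinh y - y) 0 \<le> (\<lambda>y. sinh y - y) x"
    by (rule DERIV_nonneg_imp_nondecreasing[OF assms])
       (auto intro!: exI derivative_eq_intros simp: cosh_real_ge_1)
  then show ?thesis by simp
qed

lemma tanh_le_self:
  fixes x :: real
  assumes "0 \<le> x"
  shows "tanh x \<le> x"
proof -
  have "(\<lambda>y. y - tanh y) 0 \<le> (\<lambda>y. y - tanh y) x"
    by (rule DERIV_nonneg_imp_nondecreasing[OF assms])
       (auto intro!: exI derivative_eq_intros)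
  then show ?thesis by simp
qed

lemma tanh_div_antimono:
  fixes v w :: real
  assumes "0 < v" "v \<le> w"
  shows "tanh w / w \<le> tanh v / v"
proof (rule DERIV_nonpos_imp_nonincreasing[OF assms(2)])
  fix x :: real
  assume "v \<le> x" "x \<le> w"
  with assms have x: "0 < x" by simp
  \<comment> \<open>Multiplying by \<open>(cosh x)\<^sup>2\<close> turns the numerator of the
    derivative of \<open>tanh x / x\<close> into \<open>x - sinh x * cosh x\<close>.\<close>
  have "x \<le> sinh x * cosh x"
    using mult_mono[OF sinh_ge_self cosh_real_ge_1, of x x] x by simp
  then have "(1 - (tanh x)\<^sup>2) * x \<le> tanh x"
    using hyperbolic_pythagoras[of x]
    by (simp add: tanh_def divide_simps power2_eq_square)
  then have "((1 - (tanh x)\<^sup>2) * x - tanh x) / (x * x) \<le> 0"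
    by (simp add: divide_nonpos_nonneg)
  moreover have "((\<lambda>x. tanh x / x) has_real_derivative
      ((1 - (tanh x)\<^sup>2) * x - tanh x) / (x * x)) (at x)"
    using x by (auto intro!: derivative_eq_intros)
  ultimately show "\<exists>y. ((\<lambda>x. tanh x / x) has_real_derivative y) (at x) \<and> y \<le> 0"
    by blast
qed

lemma ln_cosh_le_tangent:
  fixes v w :: real
  assumes "0 \<le> v" "0 < w"
  shows "ln (cosh v) \<le> ln (cosh w) + tanh w / (2 * w) * (v\<^sup>2 - w\<^sup>2)"
proof -
  \<comment> \<open>Up to a constant, the gap between tangent and function. For \<open>x > 0\<close>
    its derivative is \<open>x\<close> times \<open>tanh w / w - tanh x / x\<close>, which changes
    sign at \<open>w\<close>, so \<open>D\<close> is least there.\<close>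
  define D where "D = (\<lambda>x. tanh w / (2 * w) * x\<^sup>2 - ln (cosh x))"
  have D: "(D has_real_derivative (tanh w / w * x - tanh x)) (at x)" for x
    unfolding D_def using assms
    by (auto intro!: derivative_eq_intros simp: tanh_def)
  have "D w \<le> D v"
  proof (cases "v \<le> w")
    case True
    show ?thesis
    proof (rule DERIV_nonpos_imp_nonincreasing[OF True])
      fix x assume x: "v \<le> x" "x \<le> w"
      have "tanh w / w * x \<le> tanh x"
      \<comment> \<open>At 0 the quotient \<open>tanh x / x\<close> takes the default value 0
        instead of its limit 1, so this point is treated separately.\<close>
      proof (cases "x = 0")
        case False
        then have "0 < x" using x assms by simp
        then show ?thesis
          using tanh_div_antimono[of x w] x by (simp add: pos_le_divide_eq)
      qed simp
      then show "\<exists>y. (D has_real_derivative y) (at x) \<and> y \<le> 0"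
        using D by (intro exI[of _ "tanh w / w * x - tanh x"]) auto
    qed
  next
    case False
    then have wv: "w \<le> v" by simp
    show ?thesis
    proof (rule DERIV_nonneg_imp_nondecreasing[OF wv])
      fix x assume x: "w \<le> x" "x \<le> v"
      then have "0 < x" using assms by simp
      then have "tanh x \<le> tanh w / w * x"
        using tanh_div_antimono[of w x] x assms by (simp add: pos_divide_le_eq)
      then show "\<exists>y. (D has_real_derivative y) (at x) \<and> 0 \<le> y"
        using D by (intro exI[of _ "tanh w / w * x - tanh x"]) auto
    qed
  qed
  then show ?thesis by (simp add: D_def algebra_simps)
qed

lemma cosh_le_exp_quadratic:
  fixes v w :: real
  assumes "w \<noteq> 0"
  shows "cosh v \<le> cosh w * exp (tanh w / (2 * w) * (v\<^sup>2 - w\<^sup>2))"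
proof -
  \<comment> \<open>Everything is even in \<open>v\<close> and in \<open>w\<close>, which removes
    the sign conditions.\<close>
  have "tanh \<bar>w\<bar> / (2 * \<bar>w\<bar>) = tanh w / (2 * w)"
    by (simp add: abs_if)
  then have "ln (cosh v) \<le> ln (cosh w) + tanh w / (2 * w) * (v\<^sup>2 - w\<^sup>2)"
    using ln_cosh_le_tangent[of "\<bar>v\<bar>" "\<bar>w\<bar>"] assms by simp
  then have "exp (ln (cosh v)) \<le> exp (ln (cosh w) + tanh w / (2 * w) * (v\<^sup>2 - w\<^sup>2))"
    by (subst exp_le_cancel_iff)
  then show ?thesis by (simp add: exp_add)
qed

lemma logit_ne_0:
  fixes p :: real
  assumes "0 < p" "p < 1" "p \<noteq> 1/2"
  shows "ln (p / (1 - p)) \<noteq> 0"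
  using assms by (simp add: field_simps)

lemma tanh_half_logit:
  fixes p :: real
  assumes "0 < p" "p < 1"
  shows "tanh (ln (p / (1 - p)) / 2) = 2 * p - 1"
  using assms by (simp add: tanh_real_altdef exp_minus field_simps)

text \<open>With \<open>w\<close> half the log-odds, \<open>1/2 - p\<close> is
  \<open>- tanh w / 2\<close>, so the quantity is \<open>tanh w / (4 * w)\<close>, an even function
  of \<open>w\<close>.\<close>

lemma logit_ratio_bounds:
  fixes p :: real
  assumes "0 < p" "p < 1" "p \<noteq> 1/2"
  shows "0 < - ((1/2 - p) / ln (p / (1 - p)))"
    and "- ((1/2 - p) / ln (p / (1 - p))) \<le> 1/4"
proof -
  define w where "w = ln (p / (1 - p)) / 2"
  have w: "w \<noteq> 0" "tanh w = 2 * p - 1"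
    using logit_ne_0[OF assms] tanh_half_logit assms by (auto simp: w_def)
  have eq: "- ((1/2 - p) / ln (p / (1 - p))) = tanh \<bar>w\<bar> / (4 * \<bar>w\<bar>)"
  proof -
    have "tanh \<bar>w\<bar> / (4 * \<bar>w\<bar>) = tanh w / (4 * w)" by (simp add: abs_if)
    also have "\<dots> = - ((1/2 - p) / ln (p / (1 - p)))"
      using w by (simp add: w_def field_simps)
    finally show ?thesis by simp
  qed
  show "0 < - ((1/2 - p) / ln (p / (1 - p)))"
    unfolding eq using w assms(3) by (intro divide_pos_pos) auto
  show "- ((1/2 - p) / ln (p / (1 - p))) \<le> 1/4"
    unfolding eq using w tanh_le_self[of "\<bar>w\<bar>"] by (simp add: divide_simps)
qed

lemma Kearns_Saul:
  fixes p l :: real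
  assumes "0 < p" "p < 1" "p \<noteq> 1/2"
  shows "1 + p * (exp l - 1) \<le> exp (l * p - (1/2 - p) / ln (p / (1 - p)) * l\<^sup>2 / 2)"
proof -
  define w where "w = ln (p / (1 - p)) / 2"
  define v where "v = l / 2 + w"
  define K where "K = (1/2 - p) / ln (p / (1 - p))"
  have w: "w \<noteq> 0" "tanh w = 2 * p - 1"
    using logit_ne_0[OF assms] tanh_half_logit assms by (auto simp: w_def)
  have Kw: "K * w = (1/2 - p) / 2"
    using w(1) by (simp add: K_def w_def)
  have tK: "tanh w / (2 * w) = - 2 * K"
    using w by (simp add: K_def w_def field_simps)
  have ew: "exp w * exp w = p / (1 - p)"
    using assms by (simp flip: exp_add add: w_def)
  have *: "exp x * cosh x = (1 + exp x * exp x) / 2" for x :: real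
    by (simp add: cosh_def exp_minus field_simps)
  have ev: "exp v * exp v = exp l * (exp w * exp w)"
    by (simp flip: exp_add add: v_def)
  \<comment> \<open>The extra factors \<open>exp w\<close> and \<open>exp v\<close> leave only
    squares of exponentials, which are rational in \<open>p\<close> and
    \<open>exp l\<close>.\<close>
  have "(1 + p * (exp l - 1)) * (exp w * cosh w) = exp v * cosh v"
    unfolding * ev ew using assms by (simp add: field_simps)
  also have "exp v = exp (l / 2) * exp w"
    by (simp add: v_def exp_add)
  finally have "(1 + p * (exp l - 1)) * cosh w = exp (l / 2) * cosh v"
    by simp
  also have "\<dots> \<le> exp (l / 2) * (cosh w * exp (- 2 * K * (v\<^sup>2 - w\<^sup>2)))"
    using cosh_le_exp_quadratic[OF w(1), of v] by (simp add: tK)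
  also have "\<dots> = exp (l / 2 - 2 * K * (v\<^sup>2 - w\<^sup>2)) * cosh w"
    by (simp add: mult_ac flip: exp_add)
  \<comment> \<open>Here \<open>v\<^sup>2 - w\<^sup>2\<close> is
    \<open>l\<^sup>2 / 4 + l * w\<close>; the value of \<open>K * w\<close> then turns the linear
    part into \<open>l * p\<close>.\<close>
  also have "l / 2 - 2 * K * (v\<^sup>2 - w\<^sup>2) = l / 2 - K * l\<^sup>2 / 2 - 2 * l * (K * w)"
    by (simp add: v_def power2_eq_square algebra_simps)
  also have "\<dots> = l * p - K * l\<^sup>2 / 2"
    unfolding Kw by (simp add: field_simps)
  finally show ?thesis by (simp add: K_def)
qed

text \<open>The denominator averages negative ratios, so the exponent is at most 0. With bare
  logarithms there, as in the English formula, the bound would fail: for \<open>n = 1\<close>,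
  \<open>t = 1/10\<close> and \<open>\<mu> 1\<close> tending to 1/2 from below it would tend to 0,
  while the infimum does not.\<close>

theorem proposition7:
  fixes n :: nat and \<mu> :: "nat \<Rightarrow> real" and t :: real
  assumes "n \<ge> 1"
    and "\<And>i. i \<in> {1..n} \<Longrightarrow> \<mu> i \<in> {0<..<1}"
    and "\<And>i. i \<in> {1..n} \<Longrightarrow> \<mu> i \<noteq> 1/2"
    and "t \<ge> 0"
  shows "rho_exp_star n \<mu> t
           \<le> exp ((real n * t\<^sup>2 / 2) /
                 ((1 / real n) * (\<Sum>i=1..n. (1/2 - \<mu> i) / ln (\<mu> i / (1 - \<mu> i)))))
         \<and> rho_exp_star n \<mu> t \<le> rho_Hoeffding n t"
proof -
  define k where "k i = (1/2 - \<mu> i) / ln (\<mu> i / (1 - \<mu> i))" for i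
  define K where "K = - ((1 / real n) * (\<Sum>i=1..n. k i))"
  define l where "l = t / K"
  have n: "real n > 0" using assms(1) by simp
  have \<mu>: "0 < \<mu> i" "\<mu> i < 1" "\<mu> i \<noteq> 1/2" if "i \<in> {1..n}" for i
    using assms(2,3)[OF that] by auto
  have k: "0 < - k i" "- k i \<le> 1/4" if "i \<in> {1..n}" for i
    using logit_ratio_bounds[OF \<mu>[OF that]] by (auto simp: k_def)
  have sum_k: "(\<Sum>i=1..n. k i) = - (real n * K)"
    using n by (simp add: K_def)
  have "0 < (\<Sum>i=1..n. - k i)"
    using assms(1) k(1) by (intro sum_pos) auto
  then have K_pos: "0 < K"
    using n unfolding sum_negf sum_k by (simp add: zero_less_mult_iff)
  have "(\<Sum>i=1..n. - k i) \<le> (\<Sum>i=1..n. 1/4)"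
    using k(2) by (intro sum_mono)
  then have K_le: "K \<le> 1/4"
    using n unfolding sum_negf sum_k by simp

  \<comment> \<open>Nonnegativity serves twice: it bounds the objective below, so that the infimum
    is at most the value at \<open>l\<close>, and it lets the factorwise bounds be
    multiplied.\<close>
  have factor_nonneg: "0 \<le> 1 + \<mu> i * (exp x - 1)" if "i \<in> {1..n}" for i x
  proof -
    have "1 + \<mu> i * (exp x - 1) = (1 - \<mu> i) + \<mu> i * exp x"
      by (simp add: algebra_simps)
    also have "\<dots> \<ge> 0"
      using \<mu>[OF that] by (intro add_nonneg_nonneg mult_nonneg_nonneg) auto
    finally show ?thesis .
  qed
  have bdd: "bdd_below (range (\<lambda>x. exp (- real n * x * (mean_bar n \<mu> + t)) *
      (\<Prod>i=1..n. 1 + \<mu> i * (exp x - 1))))"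
    by (rule bdd_belowI[of _ 0]) (auto intro!: mult_nonneg_nonneg prod_nonneg factor_nonneg)
  have mean: "(\<Sum>i=1..n. \<mu> i) = real n * mean_bar n \<mu>"
    using n by (simp add: mean_bar_def)
  have "(\<Sum>i=1..n. l * \<mu> i - k i * l\<^sup>2 / 2)
      = l * (\<Sum>i=1..n. \<mu> i) - (\<Sum>i=1..n. k i) * l\<^sup>2 / 2"
    by (simp add: sum_subtractf sum_distrib_left sum_distrib_right sum_divide_distrib)
  then have sum_exponents: "(\<Sum>i=1..n. l * \<mu> i - k i * l\<^sup>2 / 2)
      = real n * l * mean_bar n \<mu> + real n * K * l\<^sup>2 / 2"
    unfolding mean sum_k by simp
  have "rho_exp_star n \<mu> t \<le> exp (- real n * l * (mean_bar n \<mu> + t)) *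
      (\<Prod>i=1..n. 1 + \<mu> i * (exp l - 1))"
    unfolding rho_exp_star_def by (rule cINF_lower[OF bdd]) simp
  also have "\<dots> \<le> exp (- real n * l * (mean_bar n \<mu> + t)) *
      (\<Prod>i=1..n. exp (l * \<mu> i - k i * l\<^sup>2 / 2))"
    using Kearns_Saul[OF \<mu>] factor_nonneg
    by (intro mult_left_mono prod_mono) (auto simp: k_def)
  also have "\<dots> = exp (- real n * l * (mean_bar n \<mu> + t)
      + (real n * l * mean_bar n \<mu> + real n * K * l\<^sup>2 / 2))"
    unfolding exp_add sum_exponents[symmetric] by (simp add: exp_sum)
  \<comment> \<open>The mean cancels, leaving \<open>n * (K * l\<^sup>2 / 2 - l * t)\<close>,
    evaluated at its minimiser.\<close>
  also have "- real n * l * (mean_bar n \<mu> + t)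
      + (real n * l * mean_bar n \<mu> + real n * K * l\<^sup>2 / 2) = - (real n * t\<^sup>2 / 2 / K)"
    using K_pos by (simp add: l_def field_simps power2_eq_square)
  finally have bound: "rho_exp_star n \<mu> t \<le> exp (- (real n * t\<^sup>2 / 2 / K))" .
  \<comment> \<open>Hoeffding's exponent is the case \<open>K = 1/4\<close>, the largest value that
    \<open>K_le\<close> permits.\<close>
  have "2 * real n * t\<^sup>2 \<le> real n * t\<^sup>2 / 2 / K"
  proof -
    have "real n * t\<^sup>2 / 2 / (1/4) \<le> real n * t\<^sup>2 / 2 / K"
      using K_pos K_le by (intro divide_left_mono) auto
    then show ?thesis by simp
  qed
  then have "exp (- (real n * t\<^sup>2 / 2 / K)) \<le> rho_Hoeffding n t"
    by (simp add: rho_Hoeffding_def)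
  moreover have "- (real n * t\<^sup>2 / 2 / K)
      = (real n * t\<^sup>2 / 2) / ((1 / real n) * (\<Sum>i=1..n. k i))"
    by (simp add: K_def)
  ultimately show ?thesis
    using bound unfolding k_def by auto
qed

end
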